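(* Let $Q$ be a precoherent semiprequantale (resp., precoherent near prequantale, precoherent prequantale) and let $\star$ be a nucleus on $Q$. Define $x^{\star_f} = \bigvee\{y^\star : y \in \mathsf{K}(Q),\ y \le x\}$ for all $x \in Q$. Then $\star_f$ is the largest finitary nucleus on $Q$ that is smaller than $\star$, the ordered magma $Q^{\star_f}$ is also a precoherent semiprequantale (resp., precoherent near prequantale, precoherent prequantale), and $\mathsf{K}(Q^{\star_f}) = \mathsf{K}(Q)^{\star_f}$.
   Context: An ordered magma is a set $M$ with a binary operation (written multiplicatively) and a partial order such that $x\le x'$, $y \le y'$ imply $xy \le x'y'$. A prequantale (resp., near prequantale, semiprequantale) is an ordered magma $Q$ such that $\bigvee X$ exists and $a(\bigvee X) = \bigvee(aX)$ and $(\bigvee X)a = \bigvee(Xa)$ for every $a \in Q$ and every subset $X$ of $Q$ (resp., every nonempty subset $X$, every nonempty subset $X$ that is finite or bounded above). A closure operation on a poset is a self-map $\star: x\mapsto x^\star$ that is expansive ($x \le x^\star$), order-preserving and idempotent. A nucleus on an ordered magma $M$ is a closure operation $\star$ on $M$ with $x^\star y^\star \le (xy)^\star$ for all $x,y\in M$; the image $M^\star$ is then an ordered magma under the induced order and $\star$-multiplication $(x,y)\mapsto (xy)^\star$. For a subset $Y$, $Y^\star = \{y^\star : y\in Y\}$. A directed subset is a nonempty subset $\Delta$ in which every finite subset has an upper bound in $\Delta$. A closure operation $\star$ on a poset $S$ is finitary if $(\bigvee \Delta)^\star = \bigvee(\Delta^\star)$ for all directed $\Delta \subseteq S$ for which $\bigvee\Delta$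 exists. Self-maps are compared pointwise ("smaller" means $\le$ pointwise, not necessarily strictly). An element $x$ of a poset $S$ is compact if, whenever $x \le \bigvee\Delta$ for a directed subset $\Delta$ of $S$ for which $\bigvee\Delta$ exists, one has $x \le y$ for some $y \in \Delta$; $\mathsf{K}(S)$ is the set of compact elements of $S$. An ordered magma $M$ is precoherent if every element of $M$ is the supremum of a set of compact elements of $M$ and $\mathsf{K}(M)$ is closed under multiplication. *)

theory Defs
  imports "HOL-Library.Lub_Glb" "HOL-Library.FuncSet"
begin

text \<open>
  A poset is a subset \<open>A\<close> of a partially ordered type with the induced order, and suprema are taken
  relative to \<open>A\<close> (\<^const>\<open>isLub\<close> \<open>A X s\<close>: \<open>s\<close> is the least element of \<open>A\<close> above all of \<open>X\<close>).
  A multiplication is an explicit function, since a set such as the image of a nucleus has the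
  induced order but a multiplication of its own.  Only the values of multiplications
  and self-maps on \<open>A\<close> matter.
\<close>

text \<open>The value is meaningful only if the supremum of \<open>X\<close> in \<open>A\<close> exists.\<close>

definition lub_in :: "'a::order set \<Rightarrow> 'a set \<Rightarrow> 'a" where
  "lub_in A X = (THE s. isLub A X s)"

definition directed_in :: "'a::order set \<Rightarrow> 'a set \<Rightarrow> bool" where
  "directed_in A D \<longleftrightarrow> D \<subseteq> A \<and> D \<noteq> {} \<and> (\<forall>F. F \<subseteq> D \<and> finite F \<longrightarrow> (\<exists>u\<in>D. \<forall>x\<in>F. x \<le> u))"

definition compact_elements :: "'a::order set \<Rightarrow> 'a set" where
  "compact_elements A =
     {x \<in> A. \<forall>D s. directed_in A D \<and> isLub A D s \<and> x \<le> s \<longrightarrow> (\<exists>y\<in>D. x \<le> y)}"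

definition ordered_magma :: "'a::order set \<Rightarrow> ('a \<Rightarrow> 'a \<Rightarrow> 'a) \<Rightarrow> bool" where
  "ordered_magma A mul \<longleftrightarrow>
     (\<forall>x\<in>A. \<forall>y\<in>A. mul x y \<in> A) \<and>
     (\<forall>x\<in>A. \<forall>x'\<in>A. \<forall>y\<in>A. \<forall>y'\<in>A. x \<le> x' \<and> y \<le> y' \<longrightarrow> mul x y \<le> mul x' y')"

text \<open>
  \<open>X\<close> has a supremum \<open>s\<close> in \<open>A\<close>, and for all \<open>a\<close> the products \<open>as\<close> and \<open>sa\<close> are the
  suprema of \<open>aX\<close> and \<open>Xa\<close> (whose existence is part of the claim).
\<close>

definition distributive_sup :: "'a::order set \<Rightarrow> ('a \<Rightarrow> 'a \<Rightarrow> 'a) \<Rightarrow> 'a set \<Rightarrow> bool" where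
  "distributive_sup A mul X \<longleftrightarrow>
     (\<exists>s. isLub A X s \<and>
        (\<forall>a\<in>A. isLub A ((\<lambda>x. mul a x) ` X) (mul a s) \<and> isLub A ((\<lambda>x. mul x a) ` X) (mul s a)))"

definition prequantale :: "'a::order set \<Rightarrow> ('a \<Rightarrow> 'a \<Rightarrow> 'a) \<Rightarrow> bool" where
  "prequantale A mul \<longleftrightarrow> ordered_magma A mul \<and> (\<forall>X. X \<subseteq> A \<longrightarrow> distributive_sup A mul X)"

definition near_prequantale :: "'a::order set \<Rightarrow> ('a \<Rightarrow> 'a \<Rightarrow> 'a) \<Rightarrow> bool" where
  "near_prequantale A mul \<longleftrightarrow>
     ordered_magma A mul \<and> (\<forall>X. X \<subseteq> A \<and> X \<noteq> {} \<longrightarrow> distributive_sup A mul X)"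

definition semiprequantale :: "'a::order set \<Rightarrow> ('a \<Rightarrow> 'a \<Rightarrow> 'a) \<Rightarrow> bool" where
  "semiprequantale A mul \<longleftrightarrow>
     ordered_magma A mul \<and>
     (\<forall>X. X \<subseteq> A \<and> X \<noteq> {} \<and> (finite X \<or> (\<exists>u. isUb A X u)) \<longrightarrow> distributive_sup A mul X)"

definition precoherent :: "'a::order set \<Rightarrow> ('a \<Rightarrow> 'a \<Rightarrow> 'a) \<Rightarrow> bool" where
  "precoherent A mul \<longleftrightarrow>
     ordered_magma A mul \<and>
     (\<forall>x\<in>A. \<exists>X. X \<subseteq> compact_elements A \<and> isLub A X x) \<and>
     (\<forall>x\<in>compact_elements A. \<forall>y\<in>compact_elements A. mul x y \<in> compact_elements A)"

definition closure_operation :: "'a::order set \<Rightarrow> ('a \<Rightarrow> 'a) \<Rightarrow> bool" where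
  "closure_operation A star \<longleftrightarrow>
     star \<in> A \<rightarrow> A \<and> (\<forall>x\<in>A. x \<le> star x) \<and> mono_on A star \<and> (\<forall>x\<in>A. star (star x) = star x)"

definition nucleus :: "'a::order set \<Rightarrow> ('a \<Rightarrow> 'a \<Rightarrow> 'a) \<Rightarrow> ('a \<Rightarrow> 'a) \<Rightarrow> bool" where
  "nucleus A mul star \<longleftrightarrow>
     closure_operation A star \<and> (\<forall>x\<in>A. \<forall>y\<in>A. mul (star x) (star y) \<le> star (mul x y))"

definition finitary :: "'a::order set \<Rightarrow> ('a \<Rightarrow> 'a) \<Rightarrow> bool" where
  "finitary A star \<longleftrightarrow>
     (\<forall>D s. directed_in A D \<and> isLub A D s \<longrightarrow> isLub A (star ` D) (star s))"

definition star_mult :: "('a \<Rightarrow> 'a) \<Rightarrow> ('a \<Rightarrow> 'a \<Rightarrow> 'a) \<Rightarrow> 'a \<Rightarrow> 'a \<Rightarrow> 'a" where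
  "star_mult star mul x y = star (mul x y)"

definition star_f :: "'a::order set \<Rightarrow> ('a \<Rightarrow> 'a) \<Rightarrow> 'a \<Rightarrow> 'a" where
  "star_f A star x = lub_in A {star y | y. y \<in> compact_elements A \<and> y \<le> x}"

end

theory Submission
  imports Defs
begin

text \<open>
  The compact elements below \<open>x\<close> form a directed set with supremum \<open>x\<close>: finite nonempty suprema
  of compact elements are compact, and the least element, if there is one, is compact.
  Hence \<open>\<star>\<^sub>f\<close> agrees with \<open>\<star>\<close> on compact elements, and a compact element lies below \<open>x\<^sup>\<star>\<^sup>f\<close>
  only if it lies below \<open>y\<^sup>\<star>\<close> for a single compact \<open>y \<le> x\<close>; this yields idempotence and
  finitarity.  Since \<open>\<star>\<^sub>f\<close> is finitary, directed suprema in its image are the suprema in \<open>Q\<close>,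
  which transfers compactness to the image.
\<close>

section \<open>Suprema, directed sets and compact elements in a subposet\<close>

lemma isLub_iff:
  "isLub A X s \<longleftrightarrow> s \<in> A \<and> (\<forall>x\<in>X. x \<le> s) \<and> (\<forall>u\<in>A. (\<forall>x\<in>X. x \<le> u) \<longrightarrow> s \<le> u)"
  unfolding isLub_def leastP_def isUb_def setle_def setge_def by auto

lemma isUb_iff: "isUb A X u \<longleftrightarrow> u \<in> A \<and> (\<forall>x\<in>X. x \<le> u)"
  unfolding isUb_def setle_def by auto

lemma isLub_unique: "isLub A X s \<Longrightarrow> isLub A X t \<Longrightarrow> (s::'a::order) = t"
  unfolding isLub_iff by (blast intro: order.antisym)

lemma lub_in_eq: "isLub A X s \<Longrightarrow> lub_in A X = s"
  unfolding lub_in_def by (blast intro: isLub_unique)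

lemma directed_in_image:
  assumes "directed_in A D" "mono_on A f" "f ` A \<subseteq> B"
  shows "directed_in B (f ` D)"
  unfolding directed_in_def
proof (intro conjI allI impI)
  show "f ` D \<subseteq> B" "f ` D \<noteq> {}" using assms by (auto simp: directed_in_def)
  fix F assume "F \<subseteq> f ` D \<and> finite F"
  then obtain G where G: "G \<subseteq> D" "finite G" "F = f ` G" by (meson finite_subset_image)
  then obtain u where u: "u \<in> D" "\<forall>x\<in>G. x \<le> u" using assms(1) unfolding directed_in_def by blast
  have "f x \<le> f u" if "x \<in> G" for x
  proof (rule mono_onD[OF assms(2)])
    show "x \<in> A" "u \<in> A" using that u(1) G(1) assms(1) by (auto simp: directed_in_def)
    show "x \<le> u" using that u(2) by blast
  qed
  then show "\<exists>u\<in>f ` D. \<forall>x\<in>F. x \<le> u" using u G by blast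
qed

lemma compact_elementsD:
  assumes "x \<in> compact_elements A" "directed_in A D" "isLub A D s" "x \<le> s"
  obtains y where "y \<in> D" "x \<le> y"
  using assms unfolding compact_elements_def by blast

lemma compact_elements_subset: "compact_elements A \<subseteq> A"
  unfolding compact_elements_def by blast

text \<open>Directedness of \<open>D\<close> replaces the elements chosen above the members of
  \<open>F\<close> by one common bound in \<open>D\<close>. The case of empty \<open>F\<close> is
  included: \<open>s\<close> is then a least element, and any member of \<open>D\<close> lies above
  it.\<close>

lemma compact_elements_Sup_finite:
  assumes F: "finite F" "F \<subseteq> compact_elements A" and s: "isLub A F s"
  shows "s \<in> compact_elements A"
  unfolding compact_elements_def
proof (intro CollectI conjI allI impI)
  show "s \<in> A" using s by (simp add: isLub_iff)
  fix D t assume D: "directed_in A D \<and> isLub A D t \<and> s \<le> t"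
  have "\<exists>y\<in>D. x \<le> y" if x: "x \<in> F" for x
  proof -
    have "x \<le> t" using s D x unfolding isLub_iff by (blast intro: order_trans)
    then show ?thesis using D F(2) x compact_elementsD by blast
  qed
  then obtain g where g: "\<And>x. x \<in> F \<Longrightarrow> g x \<in> D \<and> x \<le> g x" by metis
  have "g ` F \<subseteq> D" "finite (g ` F)" using g F(1) by auto
  then obtain u where u: "u \<in> D" "\<forall>x\<in>g ` F. x \<le> u" using D unfolding directed_in_def by blast
  have "\<forall>x\<in>F. x \<le> u" using u g by (blast intro: order_trans)
  moreover have "u \<in> A" using u D by (auto simp: directed_in_def)
  ultimately show "\<exists>y\<in>D. s \<le> y" using s u unfolding isLub_iff by blast
qed

text \<open>By finitarity \<open>t s\<close> is the supremum of the image of \<open>D\<close> under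
  \<open>t\<close>. This image is \<open>D\<close> itself, because idempotence makes
  \<open>t\<close> fix its values, so \<open>t s = s\<close>.\<close>

lemma finitary_isLub_image:
  assumes t: "closure_operation A t" "finitary A t"
    and D: "directed_in (t ` A) D" and s: "isLub A D s"
  shows "s \<in> t ` A"
proof -
  have fixed: "t x = x" if "x \<in> t ` A" for x using t(1) that unfolding closure_operation_def by auto
  have sub: "D \<subseteq> t ` A" "t ` A \<subseteq> A"
    using D t(1) unfolding directed_in_def closure_operation_def by auto
  have "directed_in A D" using D sub unfolding directed_in_def by auto
  then have ts: "isLub A (t ` D) (t s)" using t(2) s unfolding finitary_def by blast
  have "\<forall>x\<in>D. t x = x" using fixed sub by blast
  then have "t ` D = D" by simp
  with ts s have "t s = s" using isLub_unique by metis
  then show ?thesis using s unfolding isLub_iff by (metis imageI)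
qed

section \<open>Nuclei on ordered magmas and their images\<close>

locale magma_nucleus =
  fixes Q :: "'a::order set" and mul :: "'a \<Rightarrow> 'a \<Rightarrow> 'a" and star :: "'a \<Rightarrow> 'a"
  assumes magma: "ordered_magma Q mul"
    and nuc: "nucleus Q mul star"
begin

lemma mul_closed: "x \<in> Q \<Longrightarrow> y \<in> Q \<Longrightarrow> mul x y \<in> Q"
  using magma unfolding ordered_magma_def by blast

lemma mul_mono: "\<lbrakk>x \<in> Q; x' \<in> Q; y \<in> Q; y' \<in> Q; x \<le> x'; y \<le> y'\<rbrakk> \<Longrightarrow> mul x y \<le> mul x' y'"
  using magma unfolding ordered_magma_def by blast

lemma closure: "closure_operation Q star"
  using nuc by (simp add: nucleus_def)

lemma star_closed: "x \<in> Q \<Longrightarrow> star x \<in> Q"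
  using closure by (auto simp: closure_operation_def)

lemma star_expansive: "x \<in> Q \<Longrightarrow> x \<le> star x"
  using closure by (auto simp: closure_operation_def)

lemma star_mono: "x \<in> Q \<Longrightarrow> y \<in> Q \<Longrightarrow> x \<le> y \<Longrightarrow> star x \<le> star y"
  using closure by (auto simp: closure_operation_def mono_on_def)

lemma star_idem: "x \<in> Q \<Longrightarrow> star (star x) = star x"
  using closure by (auto simp: closure_operation_def)

lemma star_mul_le: "x \<in> Q \<Longrightarrow> y \<in> Q \<Longrightarrow> mul (star x) (star y) \<le> star (mul x y)"
  using nuc by (auto simp: nucleus_def)

text \<open>Makes \<open>star\<close> a homomorphism onto its image with \<open>star_mult\<close>,
  so products there can be computed on unclosed factors. The nucleus inequality with idempotence
  gives one direction, expansiveness the other.\<close>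

lemma star_mul_star:
  assumes "x \<in> Q" "y \<in> Q"
  shows "star (mul (star x) (star y)) = star (mul x y)"
proof (rule order.antisym)
  have "star (mul (star x) (star y)) \<le> star (star (mul x y))"
    using assms by (intro star_mono star_mul_le mul_closed star_closed)
  then show "star (mul (star x) (star y)) \<le> star (mul x y)" using assms star_idem mul_closed by simp
  show "star (mul x y) \<le> star (mul (star x) (star y))"
    using assms by (intro star_mono mul_mono mul_closed star_closed star_expansive)
qed

text \<open>Exhibits \<open>star\<close>, as a map onto its image, as left adjoint to the inclusion
  of that image into \<open>Q\<close>.\<close>

lemma star_le_iff: "x \<in> Q \<Longrightarrow> u \<in> star ` Q \<Longrightarrow> star x \<le> u \<longleftrightarrow> x \<le> u"
  using star_closed star_expansive star_idem star_mono by (smt (verit) imageE order_trans)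

lemma image_subset: "star ` Q \<subseteq> Q"
  using star_closed by blast

lemma star_fixed: "x \<in> star ` Q \<Longrightarrow> star x = x"
  using star_idem by blast

text \<open>Left adjoints preserve suprema.\<close>

lemma isLub_star_image:
  assumes "X \<subseteq> Q" "isLub Q X s"
  shows "isLub (star ` Q) (star ` X) (star s)"
  unfolding isLub_iff
proof (intro conjI ballI impI)
  have s: "s \<in> Q" using assms by (simp add: isLub_iff)
  then show "star s \<in> star ` Q" by simp
  show "x \<le> star s" if "x \<in> star ` X" for x
    using that assms s star_mono by (auto simp: isLub_iff)
  fix u assume u: "u \<in> star ` Q" and "\<forall>x\<in>star ` X. x \<le> u"
  then have "\<forall>x\<in>X. x \<le> u" using assms(1) star_le_iff[OF _ u] by blast
  then have "s \<le> u" using assms u image_subset unfolding isLub_iff by blast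
  then show "star s \<le> u" using star_le_iff s u by blast
qed

lemma ordered_magma_image: "ordered_magma (star ` Q) (star_mult star mul)"
  unfolding ordered_magma_def star_mult_def
  using mul_closed star_closed by (auto intro!: star_mono mul_mono)

text \<open>Applying \<open>star\<close> to the two distributive laws of \<open>Q\<close> gives
  those of the image: the members of \<open>X\<close> are fixed points, and
  \<open>star_mul_star\<close> exchanges the supremum \<open>s\<close> in \<open>Q\<close> for the
  supremum \<open>star s\<close> in the image.\<close>

lemma distributive_sup_image:
  assumes X: "X \<subseteq> star ` Q" and d: "distributive_sup Q mul X"
  shows "distributive_sup (star ` Q) (star_mult star mul) X"
proof -
  obtain s where s: "isLub Q X s"
    and dl: "\<And>a. a \<in> Q \<Longrightarrow> isLub Q ((\<lambda>x. mul a x) ` X) (mul a s)"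
    and dr: "\<And>a. a \<in> Q \<Longrightarrow> isLub Q ((\<lambda>x. mul x a) ` X) (mul s a)"
    using d unfolding distributive_sup_def by blast
  have sQ: "s \<in> Q" using s by (simp add: isLub_iff)
  have XQ: "X \<subseteq> Q" using X image_subset by blast
  have "\<forall>x\<in>X. star x = x" using X star_fixed by blast
  then have "star ` X = X" by simp
  then have "isLub (star ` Q) X (star s)" using isLub_star_image[OF XQ s] by simp
  moreover have "isLub (star ` Q) (star_mult star mul a ` X) (star_mult star mul a (star s))"
    if a: "a \<in> star ` Q" for a
  proof -
    have aQ: "a \<in> Q" and fa: "star a = a" using a image_subset star_fixed by blast+
    have "isLub (star ` Q) (star ` (\<lambda>x. mul a x) ` X) (star (mul a s))"
      using XQ aQ mul_closed by (intro isLub_star_image dl) auto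
    moreover have "star (mul a (star s)) = star (mul a s)"
      using star_mul_star[OF aQ sQ] fa by simp
    ultimately show ?thesis by (simp add: star_mult_def[abs_def] image_image)
  qed
  moreover have "isLub (star ` Q) ((\<lambda>x. star_mult star mul x a) ` X) (star_mult star mul (star s) a)"
    if a: "a \<in> star ` Q" for a
  proof -
    have aQ: "a \<in> Q" and fa: "star a = a" using a image_subset star_fixed by blast+
    have "isLub (star ` Q) (star ` (\<lambda>x. mul x a) ` X) (star (mul s a))"
      using XQ aQ mul_closed by (intro isLub_star_image dr) auto
    moreover have "star (mul (star s) a) = star (mul s a)"
      using star_mul_star[OF sQ aQ] fa by simp
    ultimately show ?thesis by (simp add: star_mult_def image_image)
  qed
  ultimately show ?thesis unfolding distributive_sup_def by blast
qed

lemma prequantale_image: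
  "prequantale Q mul \<Longrightarrow> prequantale (star ` Q) (star_mult star mul)"
  unfolding prequantale_def
  using ordered_magma_image distributive_sup_image image_subset by (meson subset_trans)

lemma near_prequantale_image:
  "near_prequantale Q mul \<Longrightarrow> near_prequantale (star ` Q) (star_mult star mul)"
  unfolding near_prequantale_def
  using ordered_magma_image distributive_sup_image image_subset by (meson subset_trans)

lemma semiprequantale_image:
  assumes "semiprequantale Q mul"
  shows "semiprequantale (star ` Q) (star_mult star mul)"
  unfolding semiprequantale_def
proof (intro conjI ordered_magma_image allI impI)
  fix X assume X: "X \<subseteq> star ` Q \<and> X \<noteq> {} \<and> (finite X \<or> (\<exists>u. isUb (star ` Q) X u))"
  \<comment> \<open>An upper bound in the image is also an upper bound in \<open>Q\<close>.\<close>
  then have "finite X \<or> (\<exists>u. isUb Q X u)" using image_subset by (auto simp: isUb_iff)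
  then have "distributive_sup Q mul X"
    using X image_subset assms unfolding semiprequantale_def by (meson subset_trans)
  then show "distributive_sup (star ` Q) (star_mult star mul) X"
    using X distributive_sup_image by blast
qed

end

section \<open>The finitary nucleus on a precoherent semiprequantale\<close>

locale precoherent_nucleus = magma_nucleus +
  assumes semi: "semiprequantale Q mul"
    and prec: "precoherent Q mul"
begin

abbreviation K where "K \<equiv> compact_elements Q"

abbreviation Kle where "Kle x \<equiv> {y \<in> K. y \<le> x}"

abbreviation sf where "sf \<equiv> star_f Q star"

lemma K_Q: "y \<in> K \<Longrightarrow> y \<in> Q"
  using compact_elements_subset by blast

lemma K_mul: "x \<in> K \<Longrightarrow> y \<in> K \<Longrightarrow> mul x y \<in> K"
  using prec unfolding precoherent_def by blast

lemma isLub_exists: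
  assumes "X \<subseteq> Q" "X \<noteq> {}" "finite X \<or> (\<exists>u\<in>Q. \<forall>x\<in>X. x \<le> u)"
  shows "\<exists>s. isLub Q X s"
  using assms semi unfolding semiprequantale_def distributive_sup_def isUb_iff by blast

text \<open>The supremum \<open>s\<close> is itself an upper bound of \<open>X\<close>, so the
  semiprequantale axiom covers every nonempty set that has a supremum.\<close>

lemma isLub_mul:
  assumes "X \<subseteq> Q" "X \<noteq> {}" "isLub Q X s" "a \<in> Q"
  shows "isLub Q ((\<lambda>x. mul a x) ` X) (mul a s)" "isLub Q ((\<lambda>x. mul x a) ` X) (mul s a)"
proof -
  have "distributive_sup Q mul X"
    using assms semi unfolding semiprequantale_def isUb_iff isLub_iff by blast
  then show "isLub Q ((\<lambda>x. mul a x) ` X) (mul a s)" "isLub Q ((\<lambda>x. mul x a) ` X) (mul s a)"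
    using assms isLub_unique unfolding distributive_sup_def by metis+
qed

text \<open>Some set of compact elements has supremum \<open>x\<close>; enlarging it to all compact
  elements below \<open>x\<close> does not change the supremum.\<close>

lemma isLub_Kle:
  assumes "x \<in> Q" shows "isLub Q (Kle x) x"
proof -
  obtain X where X: "X \<subseteq> K" "isLub Q X x" using assms prec unfolding precoherent_def by blast
  then show ?thesis unfolding isLub_iff by blast
qed

lemma directed_Kle:
  assumes x: "x \<in> Q" shows "directed_in Q (Kle x)"
  unfolding directed_in_def
proof (intro conjI allI impI)
  show "Kle x \<subseteq> Q" using K_Q by blast
  show ne: "Kle x \<noteq> {}"
  proof
    assume e: "Kle x = {}"
    \<comment> \<open>A supremum of the empty set is a least element. Directed sets are nonempty, so
      a least element is compact, and \<open>x\<close> would belong to \<open>Kle x\<close>.\<close>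
    then have "\<forall>u\<in>Q. x \<le> u" using isLub_Kle[OF x] unfolding e by (simp add: isLub_iff)
    then have "x \<in> K" using x unfolding compact_elements_def directed_in_def by blast
    then show False using e by blast
  qed
  fix F assume F: "F \<subseteq> Kle x \<and> finite F"
  show "\<exists>u\<in>Kle x. \<forall>y\<in>F. y \<le> u"
  proof (cases "F = {}")
    case True then show ?thesis using ne by blast
  next
    case False
    then obtain s where s: "isLub Q F s" using isLub_exists F K_Q by blast
    then have "s \<in> K" using F by (intro compact_elements_Sup_finite) auto
    moreover have "s \<le> x" using s F x unfolding isLub_iff by blast
    ultimately show ?thesis using s unfolding isLub_iff by blast
  qed
qed

lemma Kle_nonempty: "x \<in> Q \<Longrightarrow> Kle x \<noteq> {}"
  using directed_Kle unfolding directed_in_def by blast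

lemma star_Kle: "{star y |y. y \<in> K \<and> y \<le> x} = star ` Kle x"
  by blast

text \<open>The closures involved are bounded by \<open>star x\<close>, and there is at least one of
  them, so a semiprequantale has their supremum. Only this gives the definite description in
  \<open>lub_in\<close> a meaning.\<close>

lemma isLub_sf:
  assumes x: "x \<in> Q" shows "isLub Q (star ` Kle x) (sf x)"
proof -
  have "\<forall>y\<in>star ` Kle x. y \<le> star x" using x K_Q star_mono by auto
  moreover have "star ` Kle x \<subseteq> Q" using K_Q star_closed by auto
  moreover have "star ` Kle x \<noteq> {}" using Kle_nonempty[OF x] by simp
  ultimately obtain s where "isLub Q (star ` Kle x) s"
    using isLub_exists[of "star ` Kle x"] star_closed[OF x] by blast
  then show ?thesis unfolding star_f_def star_Kle by (simp add: lub_in_eq)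
qed

lemma sf_closed: "x \<in> Q \<Longrightarrow> sf x \<in> Q"
  using isLub_sf by (simp add: isLub_iff)

lemma star_le_sf: "x \<in> Q \<Longrightarrow> y \<in> K \<Longrightarrow> y \<le> x \<Longrightarrow> star y \<le> sf x"
  using isLub_sf by (simp add: isLub_iff)

lemma sf_least: "x \<in> Q \<Longrightarrow> u \<in> Q \<Longrightarrow> (\<And>y. y \<in> K \<Longrightarrow> y \<le> x \<Longrightarrow> star y \<le> u) \<Longrightarrow> sf x \<le> u"
  using isLub_sf by (auto simp: isLub_iff)

lemma sf_le_star: "x \<in> Q \<Longrightarrow> sf x \<le> star x"
  using sf_least star_closed star_mono K_Q by blast

lemma sf_expansive:
  assumes "x \<in> Q" shows "x \<le> sf x"
proof -
  have "\<forall>y\<in>Kle x. y \<le> sf x" using assms star_le_sf star_expansive K_Q by (blast intro: order_trans)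
  then show ?thesis using isLub_Kle[OF assms] sf_closed[OF assms] unfolding isLub_iff by blast
qed

lemma sf_mono: "x \<in> Q \<Longrightarrow> y \<in> Q \<Longrightarrow> x \<le> y \<Longrightarrow> sf x \<le> sf y"
  by (rule sf_least) (auto intro: sf_closed star_le_sf order_trans)

lemma directed_star_Kle: "x \<in> Q \<Longrightarrow> directed_in Q (star ` Kle x)"
  using closure by (intro directed_in_image[OF directed_Kle]) (auto simp: closure_operation_def)

text \<open>Compactness of \<open>z\<close> is applied to the closures of the compact elements below
  \<open>x\<close>, a directed set with supremum \<open>sf x\<close>.\<close>

lemma K_le_sf:
  assumes "x \<in> Q" "z \<in> K" "z \<le> sf x"
  obtains y where "y \<in> K" "y \<le> x" "z \<le> star y"
  using compact_elementsD[OF assms(2) directed_star_Kle[OF assms(1)] isLub_sf[OF assms(1)] assms(3)]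
  by blast

lemma sf_idem:
  assumes x: "x \<in> Q" shows "sf (sf x) = sf x"
proof (rule order.antisym)
  show "sf (sf x) \<le> sf x"
  proof (rule sf_least)
    fix z assume z: "z \<in> K" "z \<le> sf x"
    then obtain y where y: "y \<in> K" "y \<le> x" "z \<le> star y" using K_le_sf x by blast
    \<comment> \<open>Closing both sides of \<open>z \<le> star y\<close> costs nothing, since
      \<open>star\<close> is idempotent.\<close>
    then have "star z \<le> star y" using z star_mono star_idem star_closed K_Q by metis
    then show "star z \<le> sf x" using star_le_sf[OF x] y by (blast intro: order_trans)
  qed (use x sf_closed in auto)
  show "sf x \<le> sf (sf x)" using x sf_closed sf_expansive by blast
qed

lemma sf_closure: "closure_operation Q sf"
  unfolding closure_operation_def mono_on_def
  by (simp add: sf_closed sf_expansive sf_mono sf_idem)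

text \<open>Both \<open>sf x\<close> and \<open>sf y\<close> are suprema of closures of compact
  elements, so distributivity, used for one factor at a time, reduces the claim to products
  \<open>mul (star a) (star b)\<close> with \<open>a\<close> and \<open>b\<close> compact. There
  \<open>mul a b\<close> is compact by precoherence, and the nucleus inequality of
  \<open>star\<close> finishes.\<close>

lemma sf_mul_le:
  assumes x: "x \<in> Q" and y: "y \<in> Q"
  shows "mul (sf x) (sf y) \<le> sf (mul x y)"
proof -
  have xy: "mul x y \<in> Q" using x y mul_closed by blast
  have sub: "star ` Kle z \<subseteq> Q" "star ` Kle z \<noteq> {}" if "z \<in> Q" for z
    using directed_star_Kle[OF that] by (auto simp: directed_in_def)
  have 1: "mul (star a) (star b) \<le> sf (mul x y)" if "a \<in> Kle x" "b \<in> Kle y" for a b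
  proof -
    have "mul a b \<in> K" "mul a b \<le> mul x y" using that x y K_mul mul_mono K_Q by auto
    then have "star (mul a b) \<le> sf (mul x y)" using star_le_sf xy by blast
    moreover have "mul (star a) (star b) \<le> star (mul a b)" using that star_mul_le K_Q by blast
    ultimately show ?thesis by (rule order_trans[rotated])
  qed
  have 2: "mul (star a) (sf y) \<le> sf (mul x y)" if a: "a \<in> Kle x" for a
  proof -
    have "star a \<in> Q" using a K_Q star_closed by blast
    then have "isLub Q ((\<lambda>z. mul (star a) z) ` star ` Kle y) (mul (star a) (sf y))"
      by (rule isLub_mul(1)[OF sub[OF y] isLub_sf[OF y]])
    then show ?thesis using 1[OF a] sf_closed[OF xy] by (auto simp: isLub_iff)
  qed
  have "isLub Q ((\<lambda>z. mul z (sf y)) ` star ` Kle x) (mul (sf x) (sf y))"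
    by (rule isLub_mul(2)[OF sub[OF x] isLub_sf[OF x] sf_closed[OF y]])
  then show ?thesis using 2 sf_closed[OF xy] by (auto simp: isLub_iff)
qed

lemma sf_nucleus: "nucleus Q mul sf"
  using sf_closure sf_mul_le by (simp add: nucleus_def)

text \<open>A compact \<open>y\<close> below the supremum of \<open>D\<close> already lies below
  some \<open>d\<close> in \<open>D\<close>, so each \<open>star y\<close> that enters
  \<open>sf s\<close> is at most \<open>sf d\<close>.\<close>

lemma sf_finitary: "finitary Q sf"
  unfolding finitary_def isLub_iff[of Q "sf ` _"]
proof (intro allI impI conjI ballI)
  fix D s assume D: "directed_in Q D \<and> isLub Q D s"
  then have s: "s \<in> Q" and DQ: "D \<subseteq> Q" by (auto simp: isLub_iff directed_in_def)
  show "sf s \<in> Q" using s sf_closed by blast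
  show "x \<le> sf s" if xD: "x \<in> sf ` D" for x
  proof -
    obtain d where d: "d \<in> D" "x = sf d" using xD by blast
    then have "d \<le> s" using D by (simp add: isLub_iff)
    then show ?thesis using d DQ s sf_mono by blast
  qed
  fix u assume u: "u \<in> Q" "\<forall>x\<in>sf ` D. x \<le> u"
  show "sf s \<le> u"
  proof (rule sf_least[OF s u(1)])
    fix y assume y: "y \<in> K" "y \<le> s"
    then obtain d where d: "d \<in> D" "y \<le> d" using D compact_elementsD by blast
    then have "star y \<le> sf d" using DQ star_le_sf y(1) by blast
    also have "sf d \<le> u" using d u(2) by blast
    finally show "star y \<le> u" .
  qed
qed

text \<open>A finitary map is determined by its values on compact elements: \<open>t x\<close> is
  the supremum of the \<open>t y\<close> with \<open>y\<close> compact below \<open>x\<close>, and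
  \<open>t y \<le> star y \<le> sf x\<close>.\<close>

lemma sf_largest:
  assumes t: "finitary Q t" "\<forall>x\<in>Q. t x \<le> star x" and x: "x \<in> Q"
  shows "t x \<le> sf x"
proof -
  have "isLub Q (t ` Kle x) (t x)"
    using t(1) directed_Kle[OF x] isLub_Kle[OF x] unfolding finitary_def by blast
  moreover have "\<forall>y\<in>Kle x. t y \<le> sf x"
    using t(2) star_le_sf[OF x] K_Q by (blast intro: order_trans)
  ultimately show ?thesis using sf_closed[OF x] by (auto simp: isLub_iff)
qed

section \<open>The image of the finitary nucleus and its compact elements\<close>

sublocale f: magma_nucleus Q mul sf
  by (rule magma_nucleus.intro[OF magma sf_nucleus])

text \<open>The left adjoint \<open>sf\<close> carries the supremum of \<open>isLub_Kle\<close> into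
  the image, where \<open>x\<close> is a fixed point.\<close>

lemma isLub_image_sf_Kle:
  assumes x: "x \<in> sf ` Q"
  shows "isLub (sf ` Q) (sf ` Kle x) x"
proof -
  have "x \<in> Q" by (rule subsetD[OF f.image_subset x])
  moreover have "Kle x \<subseteq> Q" using K_Q by blast
  ultimately have "isLub (sf ` Q) (sf ` Kle x) (sf x)" by (intro f.isLub_star_image isLub_Kle)
  then show ?thesis unfolding f.star_fixed[OF x] .
qed

lemma compact_elements_image: "compact_elements (sf ` Q) = sf ` K"
proof (intro equalityI subsetI)
  fix x assume x: "x \<in> compact_elements (sf ` Q)"
  then have xi: "x \<in> sf ` Q" using compact_elements_subset by blast
  then have xQ: "x \<in> Q" using f.image_subset by blast
  \<comment> \<open>In the image, \<open>x\<close> is the supremum of the directed set of all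
    \<open>sf y\<close> with \<open>y\<close> compact below \<open>x\<close>, so compactness puts
    \<open>x\<close> below one of them.\<close>
  have "directed_in (sf ` Q) (sf ` Kle x)"
    using sf_closure
    by (intro directed_in_image[OF directed_Kle[OF xQ]]) (auto simp: closure_operation_def)
  then obtain y where y: "y \<in> Kle x" "x \<le> sf y"
    using compact_elementsD[OF x _ isLub_image_sf_Kle[OF xi]] by blast
  moreover have "sf y \<le> x" using y xi f.star_le_iff K_Q by blast
  ultimately show "x \<in> sf ` K" by (blast intro: order.antisym)
next
  fix x assume "x \<in> sf ` K"
  then obtain k where k: "k \<in> K" "x = sf k" by blast
  show "x \<in> compact_elements (sf ` Q)"
    unfolding compact_elements_def
  proof (intro CollectI conjI allI impI)
    show "x \<in> sf ` Q" using k K_Q by blast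
    fix D s assume A: "directed_in (sf ` Q) D \<and> isLub (sf ` Q) D s \<and> x \<le> s"
    then have D: "D \<subseteq> sf ` Q" "D \<noteq> {}" and "s \<in> sf ` Q"
      unfolding directed_in_def isLub_iff by blast+
    then have DQ: "D \<subseteq> Q" and s: "s \<in> Q" using f.image_subset by blast+
    \<comment> \<open>\<open>k\<close> is known to be compact only in \<open>Q\<close>, so the
      supremum of \<open>D\<close> in \<open>Q\<close> is needed; it exists because \<open>s\<close>
      bounds \<open>D\<close>. Finitarity puts \<open>r\<close> in the image, whence
      \<open>s \<le> r\<close>.\<close>
    then obtain r where r: "isLub Q D r"
      using isLub_exists[OF DQ D(2)] A s unfolding isLub_iff by blast
    have "r \<in> sf ` Q" using finitary_isLub_image[OF sf_closure sf_finitary] A r by blast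
    then have "s \<le> r" using A r unfolding isLub_iff by blast
    moreover have "k \<le> x" using k K_Q sf_expansive by blast
    ultimately have "k \<le> r" using A by (blast intro: order_trans)
    moreover have "directed_in Q D" using A DQ unfolding directed_in_def by blast
    ultimately obtain d where d: "d \<in> D" "k \<le> d" using compact_elementsD k(1) r by blast
    \<comment> \<open>As \<open>d\<close> lies in the image, the adjunction turns
      \<open>k \<le> d\<close> into \<open>sf k \<le> d\<close>.\<close>
    then have "x \<le> d" using k D f.star_le_iff K_Q by blast
    then show "\<exists>y\<in>D. x \<le> y" using d by blast
  qed
qed

lemma precoherent_image: "precoherent (sf ` Q) (star_mult sf mul)"
  unfolding precoherent_def compact_elements_image
proof (intro conjI ballI f.ordered_magma_image)
  fix x assume x: "x \<in> sf ` Q"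
  have "sf ` Kle x \<subseteq> sf ` K" by blast
  then show "\<exists>X\<subseteq>sf ` K. isLub (sf ` Q) X x" using isLub_image_sf_Kle[OF x] by blast
next
  fix x y assume "x \<in> sf ` K" "y \<in> sf ` K"
  \<comment> \<open>By \<open>f.star_mul_star\<close> the product of \<open>sf a\<close> and
    \<open>sf b\<close> in the image is \<open>sf (mul a b)\<close>, and \<open>mul a b\<close> is
    compact if \<open>a\<close> and \<open>b\<close> are.\<close>
  then show "star_mult sf mul x y \<in> sf ` K"
    using f.star_mul_star K_Q K_mul by (auto simp: star_mult_def)
qed

end

section \<open>Inclusions between the three classes, and the conclusion\<close>

lemma prequantale_imp_near: "prequantale A mul \<Longrightarrow> near_prequantale A mul"
  unfolding prequantale_def near_prequantale_def by blast

lemma near_prequantale_imp_semi: "near_prequantale A mul \<Longrightarrow> semiprequantale A mul"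
  unfolding near_prequantale_def semiprequantale_def by blast

text \<open>The variable \<open>C\<close> lets one statement cover the three parallel claims. The
  first conjunct secures the existence of the suprema behind \<open>star_f\<close>.\<close>

theorem theorem6p8:
  fixes Q :: "'a::order set"
    and mul :: "'a \<Rightarrow> 'a \<Rightarrow> 'a"
    and star :: "'a \<Rightarrow> 'a"
    and C :: "'a set \<Rightarrow> ('a \<Rightarrow> 'a \<Rightarrow> 'a) \<Rightarrow> bool"
  assumes "C \<in> {semiprequantale, near_prequantale, prequantale}"
    and "C Q mul"
    and "precoherent Q mul"
    and "nucleus Q mul star"
  shows "(\<forall>x\<in>Q. isLub Q {star y | y. y \<in> compact_elements Q \<and> y \<le> x} (star_f Q star x)) \<and>
    nucleus Q mul (star_f Q star) \<and>
    finitary Q (star_f Q star) \<and>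
    (\<forall>x\<in>Q. star_f Q star x \<le> star x) \<and>
    (\<forall>t. nucleus Q mul t \<and> finitary Q t \<and> (\<forall>x\<in>Q. t x \<le> star x)
           \<longrightarrow> (\<forall>x\<in>Q. t x \<le> star_f Q star x)) \<and>
    C (star_f Q star ` Q) (star_mult (star_f Q star) mul) \<and>
    precoherent (star_f Q star ` Q) (star_mult (star_f Q star) mul) \<and>
    compact_elements (star_f Q star ` Q) = star_f Q star ` compact_elements Q"
proof -
  \<comment> \<open>Semiprequantales form the largest of the three classes, so the construction is
    carried out there; \<open>C\<close> itself returns only for the image.\<close>
  have "semiprequantale Q mul"
    using assms(1,2) prequantale_imp_near near_prequantale_imp_semi by blast
  then interpret precoherent_nucleus Q mul star
    using assms(3,4) by unfold_locales (auto simp: semiprequantale_def)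
  have "C (sf ` Q) (star_mult sf mul)"
    using assms(1,2) f.semiprequantale_image f.near_prequantale_image f.prequantale_image by blast
  then show ?thesis
    unfolding star_Kle
    using isLub_sf sf_nucleus sf_finitary sf_le_star sf_largest precoherent_image
      compact_elements_image by blast
qed

end
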